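(* Let $B=\{x\in c:\|x\|_\infty\le 1\}$ be the closed unit ball of $c$, and let $F\colon B\to B$ be a non-expansive bijection. Then $F$ is an isometry, i.e. $\|F(x)-F(y)\|_\infty=\|x-y\|_\infty$ for all $x,y\in B$.
   Context: $c$ denotes the Banach space of convergent real sequences indexed by $\mathbb{N}=\{1,2,\dots\}$ with the supremum norm $\|\cdot\|_\infty$. A map $F$ between metric spaces is non-expansive if $d(F(a),F(b))\le d(a,b)$ for all $a,b$. *)

theory Defs
  imports "HOL-Analysis.Analysis"
begin

text \<open>
  Since \<^typ>\<open>nat\<close> carries the discrete topology, \<^typ>\<open>nat \<Rightarrow>\<^sub>C real\<close> is the Banach space of all bounded
  real sequences with the supremum norm.  Convergent sequences are bounded, so \<open>c\<close> is a subset of it and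
  inherits its norm.  Sequences are indexed from 0, i.e. the \<open>n\<close>-th entry (\<open>n \<ge> 1\<close>) is stored at \<open>n - 1\<close>.
\<close>

definition c_space :: "(nat \<Rightarrow>\<^sub>C real) set" where
  "c_space = {x. convergent (apply_bcontfun x)}"

definition c_unit_ball :: "(nat \<Rightarrow>\<^sub>C real) set" where
  "c_unit_ball = {x \<in> c_space. norm x \<le> 1}"

definition non_expansive_on :: "'a::metric_space set \<Rightarrow> ('a \<Rightarrow> 'b::metric_space) \<Rightarrow> bool" where
  "non_expansive_on A F \<longleftrightarrow> (\<forall>a\<in>A. \<forall>b\<in>A. dist (F a) (F b) \<le> dist a b)"

lemma bij_betw_c_space: "bij_betw apply_bcontfun c_space {f. convergent f}"
proof (rule bij_betwI')
  fix x y :: "nat \<Rightarrow>\<^sub>C real"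
  show "(apply_bcontfun x = apply_bcontfun y) = (x = y)"
    by (simp add: apply_bcontfun_inject)
next
  fix f :: "nat \<Rightarrow> real"
  assume "f \<in> {f. convergent f}"
  then have "convergent f" by simp
  then have "Bseq f" by (rule convergent_imp_Bseq)
  then have "f \<in> bcontfun"
    by (auto simp: bcontfun_def Bseq_eq_bounded)
  then show "\<exists>x\<in>c_space. f = apply_bcontfun x"
    using \<open>convergent f\<close> by (metis Bcontfun_inverse c_space_def mem_Collect_eq)
qed (simp add: c_space_def)

lemma norm_eq_SUP: "norm x = (SUP n. \<bar>apply_bcontfun x n\<bar>)" for x :: "nat \<Rightarrow>\<^sub>C real"
  by (simp add: norm_bcontfun_def dist_bcontfun_def dist_real_def)

lemma subspace_c_space: "subspace c_space"
  unfolding subspace_def c_space_def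
  by (auto simp: plus_bcontfun.rep_eq scaleR_bcontfun.rep_eq zero_bcontfun.rep_eq
      intro: convergent_const convergent_add convergent_mult)

end

theory Submission
  imports Defs
begin

text \<open>
  The extreme points of the ball are the convergent sequences of signs.  If \<open>e\<close> is extreme, every \<open>z\<close>
  within distance 1 of the preimages of both \<open>e\<close> and \<open>-e\<close> satisfies \<open>F z = 0 = F 0\<close>, so \<open>z = 0\<close> by
  injectivity; hence these preimages are opposite to each other and extreme.  Comparing the orthants of
  extreme points, \<open>F\<inverse>\<close> acts on them as a signed permutation of the coordinates, and one may assume that
  \<open>F\<close> fixes them.  Then \<open>F z n\<close> lies between \<open>0\<close> and \<open>z n\<close>, so \<open>F\<close> permutes each cube
  \<open>{z. \<forall>n. c \<le> e n * z n \<le> 1}\<close> with \<open>c > 0\<close>.  Such a cube is a copy of the ball of radius less than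
  \<open>1/2\<close>, and the rescaled restriction of \<open>F\<close> again fixes the extreme points.  As the cubes cover a dense
  set, \<open>F\<close> moves points at most half as far as the general bound for maps of this kind, whence \<open>F\<close> is
  the identity.
\<close>

section \<open>The ball and its extreme points as plain sequences\<close>

definition conv_ball :: "(nat \<Rightarrow> real) set" where
  "conv_ball = {x. convergent x \<and> (\<forall>n. \<bar>x n\<bar> \<le> 1)}"

definition signs :: "(nat \<Rightarrow> real) set" where
  "signs = {e. convergent e \<and> (\<forall>n. \<bar>e n\<bar> = 1)}"

lemma conv_ballI: "convergent x \<Longrightarrow> (\<And>n. \<bar>x n\<bar> \<le> 1) \<Longrightarrow> x \<in> conv_ball"
  by (simp add: conv_ball_def)

lemma conv_ball_le: "x \<in> conv_ball \<Longrightarrow> \<bar>x n\<bar> \<le> 1"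
  by (simp add: conv_ball_def)

lemma conv_ball_convergent: "x \<in> conv_ball \<Longrightarrow> convergent x"
  by (simp add: conv_ball_def)

lemma signs_conv_ball: "e \<in> signs \<Longrightarrow> e \<in> conv_ball"
  by (simp add: signs_def conv_ball_def)

lemma signs_cases: "e \<in> signs \<Longrightarrow> e n = 1 \<or> e n = -1"
  by (auto simp: signs_def abs_if dest!: spec[of _ n] split: if_splits)

lemma signs_mult_self: "e \<in> signs \<Longrightarrow> e n * e n = 1"
  using signs_cases[of e n] by auto

lemma signs_uminus: "e \<in> signs \<Longrightarrow> (\<lambda>n. - e n) \<in> signs"
  by (auto simp: signs_def convergent_minus_iff[symmetric])

lemma const_signs: "\<bar>s\<bar> = 1 \<Longrightarrow> (\<lambda>n. s) \<in> signs"
  by (simp add: signs_def convergent_const)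

lemma convergent_eventually_eq:
  fixes x y :: "nat \<Rightarrow> real"
  assumes "convergent x" "\<forall>\<^sub>F n in sequentially. x n = y n"
  shows "convergent y"
  using assms convergent_cong by blast

lemma signs_upd:
  assumes "e \<in> signs" "\<bar>s\<bar> = 1"
  shows "e(n := s) \<in> signs"
proof -
  have "\<forall>\<^sub>F k in sequentially. e k = (e(n := s)) k"
    using eventually_gt_at_top[of n] by eventually_elim auto
  then have "convergent (e(n := s))"
    using assms convergent_eventually_eq[of e] unfolding signs_def by blast
  then show ?thesis using assms by (auto simp: signs_def)
qed

definition spike :: "nat \<Rightarrow> real \<Rightarrow> nat \<Rightarrow> real" where
  "spike m t = (\<lambda>k. if k = m then t else 0)"

lemma spike_conv_ball:
  assumes "\<bar>t\<bar> \<le> 1"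
  shows "spike m t \<in> conv_ball"
proof -
  have "\<forall>\<^sub>F k in sequentially. 0 = spike m t k"
    using eventually_gt_at_top[of m] by eventually_elim (auto simp: spike_def)
  then have "convergent (spike m t)"
    using convergent_eventually_eq[of "\<lambda>_. 0"] convergent_const by blast
  then show ?thesis using assms by (auto simp: conv_ball_def spike_def)
qed

text \<open>The exact signs of a null sequence need not converge; the tolerance
  \<open>\<epsilon>\<close> allows an eventually constant choice.\<close>

lemma approx_sign:
  fixes z :: "nat \<Rightarrow> real"
  assumes "convergent z" "\<epsilon> > 0"
  obtains e where "e \<in> signs" "\<And>n. e n * z n \<ge> - \<epsilon>"
proof -
  obtain L where L: "z \<longlonglongrightarrow> L" using assms(1) by (auto simp: convergent_def)
  define s :: real where "s = (if L \<ge> 0 then 1 else -1)"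
  \<comment> \<open>Since \<open>s * L \<ge> 0\<close>, the second case occurs for finitely many
    \<open>n\<close> only.\<close>
  define e where "e = (\<lambda>n. if s * z n \<ge> - \<epsilon> then s else - s)"
  have s: "\<bar>s\<bar> = 1" "s * L > - \<epsilon>" using assms(2) by (auto simp: s_def)
  have "(\<lambda>n. s * z n) \<longlonglongrightarrow> s * L" by (intro tendsto_intros L)
  then have "\<forall>\<^sub>F n in sequentially. s * z n > - \<epsilon>" using s(2) by (rule order_tendstoD)
  then have "\<forall>\<^sub>F n in sequentially. s = e n"
    by eventually_elim (auto simp: e_def)
  then have "convergent e" using convergent_eventually_eq[of "\<lambda>_. s"] convergent_const by blast
  moreover have "\<bar>e n\<bar> = 1" for n using s by (auto simp: e_def)
  moreover have "e n * z n \<ge> - \<epsilon>" for n using assms(2) by (auto simp: e_def)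
  ultimately show ?thesis using that[of e] by (auto simp: signs_def)
qed

section \<open>Preimages of the extreme points\<close>

text \<open>A common bound \<open>r\<close> on all coordinates replaces the supremum distance, so
  that suprema never have to be computed.\<close>

locale nonexpansive_bijection =
  fixes F :: "(nat \<Rightarrow> real) \<Rightarrow> (nat \<Rightarrow> real)"
  assumes bij: "bij_betw F conv_ball conv_ball"
    and nonexpansive: "\<And>x y r n. x \<in> conv_ball \<Longrightarrow> y \<in> conv_ball \<Longrightarrow>
      (\<And>k. \<bar>x k - y k\<bar> \<le> r) \<Longrightarrow> \<bar>F x n - F y n\<bar> \<le> r"
begin

abbreviation A :: "(nat \<Rightarrow> real) \<Rightarrow> (nat \<Rightarrow> real)" where
  "A \<equiv> inv_into conv_ball F"

lemma F_in: "x \<in> conv_ball \<Longrightarrow> F x \<in> conv_ball"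
  using bij bij_betwE by blast

lemma A_in: "w \<in> conv_ball \<Longrightarrow> A w \<in> conv_ball"
  using bij by (metis bij_betw_def inv_into_into)

lemma F_A: "w \<in> conv_ball \<Longrightarrow> F (A w) = w"
  using bij by (simp add: bij_betw_inv_into_right)

lemma F_inj: "x \<in> conv_ball \<Longrightarrow> y \<in> conv_ball \<Longrightarrow> F x = F y \<Longrightarrow> x = y"
  using bij by (auto simp: bij_betw_def dest: inj_onD)

lemma zero_in: "(\<lambda>_. 0) \<in> conv_ball"
  by (simp add: conv_ball_def convergent_const)

text \<open>The origin is within 1 of the preimages of both constant sequences 1 and -1, so each
  coordinate of its image is within 1 of both 1 and -1.\<close>

lemma F_zero: "F (\<lambda>_. 0) = (\<lambda>_. 0)"
proof
  fix n
  have "\<bar>s - F (\<lambda>_. 0) n\<bar> \<le> 1" if "\<bar>s\<bar> = 1" for s :: real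
  proof -
    have s: "(\<lambda>_. s) \<in> conv_ball" using const_signs[OF that] signs_conv_ball by blast
    have "\<bar>F (A (\<lambda>_. s)) n - F (\<lambda>_. 0) n\<bar> \<le> 1"
      by (rule nonexpansive) (use A_in[OF s] zero_in conv_ball_le in auto)
    then show ?thesis by (simp add: F_A[OF s])
  qed
  from this[of 1] this[of "-1"] show "F (\<lambda>_. 0) n = 0" by simp
qed

lemma A_signs_zero:
  assumes e: "e \<in> signs" and z: "z \<in> conv_ball"
    and "\<And>n. \<bar>z n - A e n\<bar> \<le> 1" "\<And>n. \<bar>z n - A (\<lambda>n. - e n) n\<bar> \<le> 1"
  shows "z = (\<lambda>_. 0)"
proof -
  note e' = signs_conv_ball[OF e] signs_conv_ball[OF signs_uminus[OF e]]
  have "F z n = 0" for n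
    using nonexpansive[OF z A_in[OF e'(1)] assms(3), of n]
      nonexpansive[OF z A_in[OF e'(2)] assms(4), of n] signs_cases[OF e, of n]
    by (auto simp: F_A e')
  then have "F z = F (\<lambda>_. 0)" by (auto simp: F_zero)
  then show ?thesis using F_inj z zero_in by blast
qed

text \<open>The midpoint of the preimages of \<open>e\<close> and \<open>-e\<close> is sent to \<open>0 = F 0\<close>, so injectivity applies.\<close>

lemma A_uminus:
  assumes e: "e \<in> signs"
  shows "A (\<lambda>n. - e n) = (\<lambda>n. - A e n)"
proof -
  note e' = signs_conv_ball[OF e] signs_conv_ball[OF signs_uminus[OF e]]
  let ?x = "A e" and ?y = "A (\<lambda>n. - e n)"
  have x: "?x \<in> conv_ball" and y: "?y \<in> conv_ball" using A_in e' by auto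
  have b: "\<bar>?x n\<bar> \<le> 1" "\<bar>?y n\<bar> \<le> 1" for n using x y conv_ball_le by auto
  have "(\<lambda>n. (?x n + ?y n) / 2) \<in> conv_ball"
  proof (rule conv_ballI)
    show "convergent (\<lambda>n. (?x n + ?y n) / 2)"
      unfolding divide_inverse
      by (intro convergent_mult convergent_add convergent_const conv_ball_convergent x y)
    show "\<bar>(?x n + ?y n) / 2\<bar> \<le> 1" for n using b[of n] by (auto simp: abs_le_iff)
  qed
  then have "(\<lambda>n. (?x n + ?y n) / 2) = (\<lambda>_. 0)"
  proof (rule A_signs_zero[OF e])
    show "\<bar>(?x n + ?y n) / 2 - ?x n\<bar> \<le> 1" for n using b[of n] by (auto simp: abs_le_iff)
    show "\<bar>(?x n + ?y n) / 2 - ?y n\<bar> \<le> 1" for n using b[of n] by (auto simp: abs_le_iff)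
  qed
  then have "(?x n + ?y n) / 2 = 0" for n by (rule fun_cong)
  then have "?y n = - ?x n" for n using add_eq_0_iff by auto
  then show ?thesis by blast
qed

text \<open>If \<open>\<bar>A e m\<bar> < 1\<close>, a spike at \<open>m\<close> as high as the gap
  would still be within 1 of both \<open>A e\<close> and its negative, contradicting
  \<open>A_signs_zero\<close>.\<close>

lemma A_signs:
  assumes e: "e \<in> signs"
  shows "A e \<in> signs"
proof -
  have x: "A e \<in> conv_ball" using A_in e signs_conv_ball by auto
  have "\<bar>A e m\<bar> = 1" for m
  proof -
    have b: "\<bar>A e k\<bar> \<le> 1" for k using conv_ball_le[OF x] .
    have "spike m (1 - \<bar>A e m\<bar>) = (\<lambda>_. 0)"
    proof (rule A_signs_zero[OF e])
      show "spike m (1 - \<bar>A e m\<bar>) \<in> conv_ball"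
        by (rule spike_conv_ball) (use b[of m] in linarith)
    next
      show "\<bar>spike m (1 - \<bar>A e m\<bar>) n - A e n\<bar> \<le> 1" for n
        using b[of n] b[of m] by (auto simp: spike_def)
    next
      show "\<bar>spike m (1 - \<bar>A e m\<bar>) n - A (\<lambda>n. - e n) n\<bar> \<le> 1" for n
        unfolding A_uminus[OF e] using b[of n] b[of m] by (auto simp: spike_def)
    qed
    then have "spike m (1 - \<bar>A e m\<bar>) m = 0" by (rule fun_cong)
    then show ?thesis by (simp add: spike_def)
  qed
  then show ?thesis using x by (simp add: signs_def conv_ball_def)
qed

text \<open>Within the ball, lying in the closed orthant of a sign sequence means lying within 1 of
  it, and this passes from \<open>A e\<close> to \<open>e\<close>.\<close>

lemma F_orthant:
  assumes e: "e \<in> signs" and z: "z \<in> conv_ball" and "\<And>k. z k * A e k \<ge> 0"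
  shows "F z n * e n \<ge> 0"
proof -
  note e' = signs_conv_ball[OF e]
  have "\<bar>z k - A e k\<bar> \<le> 1" for k
    using assms(3)[of k] signs_cases[OF A_signs[OF e], of k] conv_ball_le[OF z, of k] by auto
  then have "\<bar>F z n - F (A e) n\<bar> \<le> 1"
    using nonexpansive[OF z A_in[OF e']] by blast
  then show ?thesis using signs_cases[OF e, of n] by (auto simp: F_A[OF e'])
qed

lemma A_signs_inj: "e \<in> signs \<Longrightarrow> f \<in> signs \<Longrightarrow> A e = A f \<Longrightarrow> e = f"
  by (metis F_A signs_conv_ball)

section \<open>The signed permutation of the coordinates\<close>

text \<open>These will be the signs of the signed permutation; \<open>F\<close> maps the orthant of
  \<open>\<sigma>\<close> into the nonnegative one.\<close>

definition \<sigma> :: "nat \<Rightarrow> real" where "\<sigma> = A (\<lambda>_. 1)"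

lemma sigma_signs: "\<sigma> \<in> signs"
  unfolding \<sigma>_def by (rule A_signs) (simp add: const_signs)

lemma F_sigma_spike:
  assumes "0 \<le> s" "s \<le> 1"
  shows "spike m (s * \<sigma> m) \<in> conv_ball" "0 \<le> F (spike m (s * \<sigma> m)) k"
proof -
  show *: "spike m (s * \<sigma> m) \<in> conv_ball"
    by (rule spike_conv_ball) (use assms signs_cases[OF sigma_signs, of m] in auto)
  have "0 \<le> F (spike m (s * \<sigma> m)) k * 1"
    by (rule F_orthant[OF _ *]) (use assms signs_mult_self[OF sigma_signs] in
        \<open>auto simp: const_signs spike_def \<sigma>_def[symmetric] mult.assoc\<close>)
  then show "0 \<le> F (spike m (s * \<sigma> m)) k" by simp
qed

lemma F_sigma_spike_nonzero:
  assumes "0 < s" "s \<le> 1"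
  shows "\<exists>k. F (spike m (s * \<sigma> m)) k \<noteq> 0"
proof (rule ccontr)
  assume "\<not> ?thesis"
  then have "F (spike m (s * \<sigma> m)) = F (\<lambda>_. 0)" by (auto simp: F_zero)
  then have "spike m (s * \<sigma> m) = (\<lambda>_. 0)"
    using F_inj F_sigma_spike[of s m] zero_in assms by auto
  then have "spike m (s * \<sigma> m) m = 0" by (rule fun_cong)
  then show False using assms signs_cases[OF sigma_signs, of m] by (auto simp: spike_def)
qed

text \<open>A spike has a single nonzero coordinate at most, so agreement of signs at
  \<open>m\<close> alone puts it into the orthant of \<open>A e\<close>.\<close>

lemma F_sigma_spike_sign:
  assumes "e \<in> signs" "A e m = \<sigma> m" "0 \<le> s" "s \<le> 1"
  shows "0 \<le> F (spike m (s * \<sigma> m)) k * e k"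
proof (rule F_orthant[OF assms(1) F_sigma_spike(1)[OF assms(3,4)]])
  show "0 \<le> spike m (s * \<sigma> m) j * A e j" for j
    using assms(2,3) signs_mult_self[OF sigma_signs, of m] by (simp add: spike_def mult.assoc)
qed

text \<open>The orthant of this point meets the nonnegative one exactly in the \<open>n\<close>-th
  half-axis.\<close>

definition vertex :: "nat \<Rightarrow> nat \<Rightarrow> real" where "vertex n = (\<lambda>_. - 1)(n := 1)"

lemma vertex_signs: "vertex n \<in> signs"
  unfolding vertex_def by (intro signs_upd const_signs) auto

lemma F_sigma_spike_vertex:
  assumes "A (vertex n) m = \<sigma> m" "0 \<le> s" "s \<le> 1" "k \<noteq> n"
  shows "F (spike m (s * \<sigma> m)) k = 0"
  using F_sigma_spike_sign[OF vertex_signs assms(1-3), of k] F_sigma_spike(2)[OF assms(2,3), of m k] assms(4)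
  by (simp add: vertex_def)

text \<open>Two rays from \<open>0\<close> are mapped injectively and continuously into the same ray from \<open>0\<close>, so they
  coincide by the intermediate value theorem.\<close>

lemma vertex_unique_aux:
  assumes m1: "A (vertex n) m1 = \<sigma> m1" and m2: "A (vertex n) m2 = \<sigma> m2"
    and le: "F (spike m1 (1 * \<sigma> m1)) n \<le> F (spike m2 (1 * \<sigma> m2)) n"
  shows "m1 = m2"
proof -
  define f where "f = (\<lambda>s. F (spike m2 (s * \<sigma> m2)) n)"
  have "dist (f s) (f t) \<le> 1 * dist s t" if "s \<in> {0..1}" "t \<in> {0..1}" for s t
  proof -
    have "\<bar>spike m2 (s * \<sigma> m2) k - spike m2 (t * \<sigma> m2) k\<bar> \<le> \<bar>s - t\<bar>" for k
      using signs_cases[OF sigma_signs, of m2] by (auto simp: spike_def)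
    then show ?thesis
      using nonexpansive F_sigma_spike(1) that unfolding f_def dist_real_def by simp
  qed
  then have "1-lipschitz_on {0..1} f" by (intro lipschitz_onI) auto
  then have "continuous_on {0..1} f" by (rule lipschitz_on_continuous_on)
  moreover have "spike m2 (0 * \<sigma> m2) = (\<lambda>_. 0)" by (auto simp: spike_def)
  then have "f 0 = 0" by (simp only: f_def F_zero)
  moreover have "0 \<le> F (spike m1 (1 * \<sigma> m1)) n" using F_sigma_spike(2)[of 1] by simp
  ultimately obtain s where s: "0 \<le> s" "s \<le> 1" "f s = F (spike m1 (1 * \<sigma> m1)) n"
    using IVT'[of f 0 _ 1] le unfolding f_def by auto
  have "F (spike m2 (s * \<sigma> m2)) = F (spike m1 (1 * \<sigma> m1))"
  proof
    fix k
    show "F (spike m2 (s * \<sigma> m2)) k = F (spike m1 (1 * \<sigma> m1)) k"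
      using s F_sigma_spike_vertex[OF m1, of 1 k] F_sigma_spike_vertex[OF m2, of s k]
      by (cases "k = n") (auto simp: f_def)
  qed
  then have "spike m2 (s * \<sigma> m2) = spike m1 (1 * \<sigma> m1)"
    using F_inj F_sigma_spike[of s m2] F_sigma_spike[of 1 m1] s by auto
  \<comment> \<open>At \<open>m1\<close> the right-hand side is \<open>\<sigma> m1\<close>, which is
    not 0, so the left spike must sit at \<open>m1\<close> too.\<close>
  then have "spike m2 (s * \<sigma> m2) m1 = spike m1 (1 * \<sigma> m1) m1" by (rule fun_cong)
  then show ?thesis using signs_cases[OF sigma_signs, of m1] by (auto simp: spike_def split: if_splits)
qed

text \<open>Without agreement anywhere, \<open>A (vertex n)\<close> would be
  \<open>- \<sigma>\<close>, the preimage of the constant -1. For uniqueness, the spike with the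
  smaller image plays the role of \<open>m1\<close> in \<open>vertex_unique_aux\<close>.\<close>

lemma vertex_ex1: "\<exists>!m. A (vertex n) m = \<sigma> m"
proof (rule ex_ex1I)
  show "\<exists>m. A (vertex n) m = \<sigma> m"
  proof (rule ccontr)
    assume *: "\<nexists>m. A (vertex n) m = \<sigma> m"
    have "A (vertex n) m = - \<sigma> m" for m
      using * signs_cases[OF sigma_signs, of m] signs_cases[OF A_signs[OF vertex_signs], of n m]
      by (metis minus_equation_iff)
    then have "A (vertex n) = A (\<lambda>_. - 1)"
      using A_uminus[OF const_signs[of 1]] by (auto simp: \<sigma>_def)
    then have "vertex n = (\<lambda>_. -1)" using A_signs_inj vertex_signs const_signs[of "-1"] by auto
    then have "vertex n n = -1" by (rule fun_cong)
    then show False by (simp add: vertex_def)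
  qed
  show "m1 = m2" if "A (vertex n) m1 = \<sigma> m1" "A (vertex n) m2 = \<sigma> m2" for m1 m2
    using vertex_unique_aux[OF that] vertex_unique_aux[OF that(2,1)] linear by blast
qed

text \<open>The coordinate whose half-axis, in direction \<open>\<sigma>\<close>, is sent by
  \<open>F\<close> into the \<open>n\<close>-th nonnegative half-axis.\<close>

definition \<pi> :: "nat \<Rightarrow> nat" where "\<pi> n = (THE m. A (vertex n) m = \<sigma> m)"

lemma A_vertex: "A (vertex n) m = \<sigma> m \<longleftrightarrow> m = \<pi> n"
  using theI'[OF vertex_ex1[of n]] vertex_ex1[of n] unfolding \<pi>_def by blast

lemma F_sigma_spike_pi: "F (spike (\<pi> n) (\<sigma> (\<pi> n))) n > 0"
proof -
  obtain k where "F (spike (\<pi> n) (1 * \<sigma> (\<pi> n))) k \<noteq> 0"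
    using F_sigma_spike_nonzero[of 1] by auto
  then show ?thesis
    using F_sigma_spike_vertex[of n "\<pi> n" 1 k] F_sigma_spike(2)[of 1 "\<pi> n" k] A_vertex
    by (cases "k = n") auto
qed

text \<open>If \<open>A e\<close> and \<open>\<sigma>\<close> agree at \<open>\<pi> n\<close>, the
  spike there has an image in the orthant of \<open>e\<close> that is positive at \<open>n\<close>,
  so \<open>e n = 1\<close>. Otherwise \<open>- e\<close> is in this situation.\<close>

lemma A_signs_pi:
  assumes e: "e \<in> signs"
  shows "A e (\<pi> n) = \<sigma> (\<pi> n) * e n"
proof -
  have 1: "e n = 1" if "e \<in> signs" "A e (\<pi> n) = \<sigma> (\<pi> n)" for e
    using F_sigma_spike_sign[OF that, of 1 n] F_sigma_spike_pi[of n] signs_cases[OF that(1), of n] by auto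
  show ?thesis
  proof (cases "A e (\<pi> n) = \<sigma> (\<pi> n)")
    case True
    then show ?thesis using 1[OF e] by simp
  next
    case False
    then have *: "A e (\<pi> n) = - \<sigma> (\<pi> n)"
      using signs_cases[OF sigma_signs, of "\<pi> n"] signs_cases[OF A_signs[OF e], of "\<pi> n"] by auto
    then have "- e n = 1" using 1[OF signs_uminus[OF e]] A_uminus[OF e] by simp
    then show ?thesis using * by auto
  qed
qed

text \<open>If \<open>\<pi> n = \<pi> k\<close>, then \<open>vertex n\<close> is 1 at
  \<open>k\<close>. If \<open>m\<close> is not a value, every \<open>- vertex n\<close> has a
  preimage agreeing with \<open>\<sigma>\<close> at \<open>m\<close>, so the image of the spike at
  \<open>m\<close> vanishes everywhere.\<close>

lemma bij_pi: "bij \<pi>"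
proof (rule bijI)
  show "inj \<pi>"
  proof (rule injI)
    fix n k assume *: "\<pi> n = \<pi> k"
    have "\<sigma> (\<pi> k) * vertex n k = \<sigma> (\<pi> k)"
      using A_signs_pi[OF vertex_signs[of n], of k] A_vertex[of n "\<pi> k"] * by simp
    then show "n = k" using signs_cases[OF sigma_signs, of "\<pi> k"] by (auto simp: vertex_def split: if_splits)
  qed
  show "surj \<pi>" unfolding surj_def
  proof (rule allI, rule ccontr)
    fix m assume *: "\<nexists>n. m = \<pi> n"
    have "F (spike m (1 * \<sigma> m)) n = 0" for n
    proof -
      have "A (vertex n) m \<noteq> \<sigma> m" using * A_vertex by blast
      then have "A (\<lambda>k. - vertex n k) m = \<sigma> m"
        using signs_cases[OF sigma_signs, of m] signs_cases[OF A_signs[OF vertex_signs], of n m]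
        by (auto simp: A_uminus[OF vertex_signs])
      from F_sigma_spike_sign[OF signs_uminus[OF vertex_signs] this, of 1 n]
      show ?thesis using F_sigma_spike(2)[of 1 m n] by (simp add: vertex_def)
    qed
    then show False using F_sigma_spike_nonzero[of 1 m] by auto
  qed
qed

end

section \<open>Maps fixing the extreme points\<close>

locale sign_fixing_bijection = nonexpansive_bijection +
  assumes fixes_signs: "\<And>e. e \<in> signs \<Longrightarrow> F e = e"
begin

text \<open>Measuring the distance to a fixed sign sequence that nearly matches the signs of
  \<open>z\<close> off \<open>n\<close> and has a prescribed sign \<open>s\<close> at
  \<open>n\<close> bounds \<open>F z n\<close> on one side; the two values of \<open>s\<close> give
  the two bounds.\<close>

lemma F_between:
  assumes z: "z \<in> conv_ball"
  shows "min (z n) 0 \<le> F z n" "F z n \<le> max (z n) 0"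
proof -
  have *: "1 - F z n * s \<le> 1 + max (- z n * s) 0 + \<epsilon>" if s: "\<bar>s\<bar> = 1" and "\<epsilon> > 0" for s \<epsilon>
  proof -
    obtain e where e: "e \<in> signs" "\<And>k. e k * z k \<ge> - \<epsilon>"
      using approx_sign[OF conv_ball_convergent[OF z] \<open>\<epsilon> > 0\<close>] by blast
    define f where "f = e(n := s)"
    have f: "f \<in> signs" unfolding f_def by (rule signs_upd[OF e(1) s])
    have "\<bar>z k - f k\<bar> \<le> 1 + max (- z n * s) 0 + \<epsilon>" for k
    proof (cases "k = n")
      case True
      then show ?thesis using s \<open>\<epsilon> > 0\<close> conv_ball_le[OF z, of n]
        by (auto simp: f_def abs_if split: if_splits)
    next
      case False
      then show ?thesis using \<open>\<epsilon> > 0\<close> conv_ball_le[OF z, of k] e(2)[of k] signs_cases[OF e(1), of k]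
        by (auto simp: f_def abs_if split: if_splits)
    qed
    then have "\<bar>F z n - F f n\<bar> \<le> 1 + max (- z n * s) 0 + \<epsilon>"
      using nonexpansive[OF z signs_conv_ball[OF f]] by blast
    then have "\<bar>F z n - s\<bar> \<le> 1 + max (- z n * s) 0 + \<epsilon>"
      unfolding fixes_signs[OF f] by (simp add: f_def)
    then show ?thesis using s by (auto simp: abs_if split: if_splits)
  qed
  have **: "- F z n * s \<le> max (- z n * s) 0" if "\<bar>s\<bar> = 1" for s
  proof (rule field_le_epsilon)
    fix \<epsilon> :: real assume "0 < \<epsilon>"
    with * that have "1 - F z n * s \<le> 1 + max (- z n * s) 0 + \<epsilon>" by blast
    then show "- F z n * s \<le> max (- z n * s) 0 + \<epsilon>" by simp
  qed
  show "min (z n) 0 \<le> F z n" "F z n \<le> max (z n) 0"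
    using **[of 1] **[of "-1"] by auto
qed

end

section \<open>Cubes as scaled copies of the ball\<close>

text \<open>The cube has centre \<open>(1 + c) / 2\<close> times \<open>e\<close> and radius
  \<open>(1 - c) / 2\<close>. The factor \<open>e n\<close> orients it so that larger coordinates of
  \<open>x\<close> lie farther from 0.\<close>

definition cube_map :: "(nat \<Rightarrow> real) \<Rightarrow> real \<Rightarrow> (nat \<Rightarrow> real) \<Rightarrow> nat \<Rightarrow> real" where
  "cube_map e c x = (\<lambda>n. e n * ((1 + c) / 2 + (1 - c) / 2 * x n))"

definition cube_unmap :: "(nat \<Rightarrow> real) \<Rightarrow> real \<Rightarrow> (nat \<Rightarrow> real) \<Rightarrow> nat \<Rightarrow> real" where
  "cube_unmap e c x = (\<lambda>n. (e n * x n - (1 + c) / 2) / ((1 - c) / 2))"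

definition cube :: "(nat \<Rightarrow> real) \<Rightarrow> real \<Rightarrow> (nat \<Rightarrow> real) set" where
  "cube e c = {x \<in> conv_ball. \<forall>n. c \<le> e n * x n}"

context
  fixes e :: "nat \<Rightarrow> real" and c :: real
  assumes e: "e \<in> signs" and c: "0 < c" "c < 1"
begin

lemma cube_map_in:
  assumes "x \<in> conv_ball"
  shows "cube_map e c x \<in> cube e c"
proof -
  have b: "c \<le> (1 + c) / 2 + (1 - c) / 2 * x n" "(1 + c) / 2 + (1 - c) / 2 * x n \<le> 1" for n
  proof -
    have "(1 - c) / 2 * x n \<le> (1 - c) / 2 * 1" "(1 - c) / 2 * (-1) \<le> (1 - c) / 2 * x n"
      using c conv_ball_le[OF assms, of n] by (intro mult_left_mono; simp)+
    then show "c \<le> (1 + c) / 2 + (1 - c) / 2 * x n" "(1 + c) / 2 + (1 - c) / 2 * x n \<le> 1"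
      by (simp_all add: field_simps)
  qed
  have 1: "e n * cube_map e c x n = (1 + c) / 2 + (1 - c) / 2 * x n" for n
    using signs_mult_self[OF e] by (simp add: cube_map_def mult.assoc[symmetric])
  have "convergent (cube_map e c x)"
    unfolding cube_map_def using e conv_ball_convergent[OF assms]
    by (intro convergent_mult convergent_add convergent_const) (auto simp: signs_def)
  moreover have "\<bar>cube_map e c x n\<bar> \<le> 1" for n
    using b[of n] c signs_cases[OF e, of n] by (auto simp: cube_map_def)
  ultimately show ?thesis using b 1 by (auto simp: cube_def intro: conv_ballI)
qed

lemma cube_unmap_in:
  assumes "x \<in> cube e c"
  shows "cube_unmap e c x \<in> conv_ball"
proof (rule conv_ballI)
  have x: "x \<in> conv_ball" "c \<le> e n * x n" for n using assms by (auto simp: cube_def)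
  show "convergent (cube_unmap e c x)"
    unfolding cube_unmap_def divide_inverse using e conv_ball_convergent[OF x(1)]
    by (intro convergent_mult convergent_diff convergent_const) (auto simp: signs_def)
  have "e n * x n \<le> 1" for n
    using conv_ball_le[OF x(1), of n] signs_cases[OF e, of n] by auto
  then have "\<bar>e n * x n - (1 + c) / 2\<bar> \<le> (1 - c) / 2" for n
    using x(2)[of n] by (intro abs_leI) (simp_all add: field_simps)
  moreover have "0 < (1 - c) / 2" using c by simp
  ultimately show "\<bar>cube_unmap e c x n\<bar> \<le> 1" for n
    by (simp only: cube_unmap_def abs_div_pos[symmetric] divide_le_eq_1_pos)
qed

lemma cube_map_unmap: "cube_map e c (cube_unmap e c x) = x"
proof
  fix n
  have "(1 - c) / 2 * ((e n * x n - (1 + c) / 2) / ((1 - c) / 2)) = e n * x n - (1 + c) / 2"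
    by (subst times_divide_eq_right) (rule nonzero_mult_div_cancel_left, use c in simp)
  then have "cube_map e c (cube_unmap e c x) n = e n * (e n * x n)"
    by (simp only: cube_map_def cube_unmap_def) simp
  then show "cube_map e c (cube_unmap e c x) n = x n"
    using signs_mult_self[OF e, of n] by (simp add: mult.assoc[symmetric])
qed

lemma cube_unmap_map: "cube_unmap e c (cube_map e c x) = x"
  using c signs_mult_self[OF e] by (auto simp: cube_map_def cube_unmap_def mult.assoc[symmetric])

lemma bij_cube_map: "bij_betw (cube_map e c) conv_ball (cube e c)"
  by (rule bij_betw_byWitness[where f' = "cube_unmap e c"])
    (auto simp: cube_map_unmap cube_unmap_map cube_map_in cube_unmap_in)

lemma bij_cube_unmap: "bij_betw (cube_unmap e c) (cube e c) conv_ball"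
  by (rule bij_betw_byWitness[where f' = "cube_map e c"])
    (auto simp: cube_map_unmap cube_unmap_map cube_map_in cube_unmap_in)

lemma cube_map_diff: "\<bar>cube_map e c x n - cube_map e c y n\<bar> = (1 - c) / 2 * \<bar>x n - y n\<bar>"
proof -
  have "cube_map e c x n - cube_map e c y n = e n * ((1 - c) / 2 * (x n - y n))"
    by (simp add: cube_map_def right_diff_distrib[symmetric])
  then show ?thesis using e c by (simp only: abs_mult) (simp add: signs_def)
qed

lemma cube_unmap_diff: "\<bar>cube_unmap e c x n - cube_unmap e c y n\<bar> = \<bar>x n - y n\<bar> / ((1 - c) / 2)"
  using cube_map_diff[of "cube_unmap e c x" n "cube_unmap e c y"] c
  by (simp add: cube_map_unmap)

end

context sign_fixing_bijection
begin

context
  fixes e :: "nat \<Rightarrow> real" and c :: real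
  assumes e: "e \<in> signs" and c: "0 < c" "c < 1"
begin

lemma bij_cube: "bij_betw F (cube e c) (cube e c)"
proof (rule bij_betw_byWitness[where f' = A])
  show "\<forall>x\<in>cube e c. A (F x) = x"
    using bij by (auto simp: cube_def bij_betw_def)
  show "\<forall>x\<in>cube e c. F (A x) = x" by (auto simp: cube_def F_A)
  show "F ` cube e c \<subseteq> cube e c"
  proof safe
    fix x assume "x \<in> cube e c"
    then have x: "x \<in> conv_ball" "\<And>n. c \<le> e n * x n" by (auto simp: cube_def)
    \<comment> \<open>The cube consists of the points of the ball within \<open>1 - c\<close> of the
      fixed point \<open>e\<close>.\<close>
    have "\<bar>x k - e k\<bar> \<le> 1 - c" for k
      using x(2)[of k] conv_ball_le[OF x(1), of k] signs_cases[OF e, of k] by auto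
    then have *: "\<bar>F x n - F e n\<bar> \<le> 1 - c" for n
      using nonexpansive[OF x(1) signs_conv_ball[OF e]] by blast
    have "c \<le> e n * F x n" for n
      using *[of n] fixes_signs[OF e] signs_cases[OF e, of n] by (auto simp: abs_le_iff)
    then show "F x \<in> cube e c" using F_in[OF x(1)] by (simp add: cube_def)
  qed
  show "A ` cube e c \<subseteq> cube e c"
  proof safe
    fix w assume "w \<in> cube e c"
    then have w: "w \<in> conv_ball" "\<And>n. c \<le> e n * w n" by (auto simp: cube_def)
    \<comment> \<open>By \<open>F_between\<close>, \<open>w n\<close> lies between 0 and
      \<open>A w n\<close>; being nonzero, it has the same sign and is no larger in modulus.\<close>
    have "c \<le> e n * A w n" for n
      using F_between[OF A_in[OF w(1)], of n] w(2)[of n] signs_cases[OF e, of n] c(1)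
      by (auto simp: F_A[OF w(1)])
    then show "A w \<in> cube e c" using A_in[OF w(1)] by (simp add: cube_def)
  qed
qed

text \<open>The rescaled map does not increase any coordinate.  Applied to the preimages of \<open>f\<close> and \<open>-f\<close>,
  which are opposite to each other, this forces \<open>f\<close> to be fixed.\<close>

lemma cube_rescale:
  "sign_fixing_bijection (cube_unmap e c \<circ> F \<circ> cube_map e c)"
proof -
  let ?G = "cube_unmap e c \<circ> F \<circ> cube_map e c"
  \<comment> \<open>This weaker structure comes first, as it provides \<open>G.A_uminus\<close> for
    the proof that signs are fixed.\<close>
  interpret G: nonexpansive_bijection ?G
  proof
    show "bij_betw ?G conv_ball conv_ball"
      by (intro bij_betw_trans[OF bij_betw_trans[OF bij_cube_map[OF e c] bij_cube] bij_cube_unmap[OF e c], unfolded comp_assoc[symmetric]])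
  next
    fix x y r n
    assume xy: "x \<in> conv_ball" "y \<in> conv_ball" "\<And>k. \<bar>x k - y k\<bar> \<le> r"
    have "cube_map e c x \<in> conv_ball" "cube_map e c y \<in> conv_ball"
      using cube_map_in[OF e c] xy by (auto simp: cube_def)
    moreover have "\<bar>cube_map e c x k - cube_map e c y k\<bar> \<le> (1 - c) / 2 * r" for k
      unfolding cube_map_diff[OF e c] by (intro mult_left_mono xy) (use c in auto)
    ultimately have "\<bar>F (cube_map e c x) n - F (cube_map e c y) n\<bar> \<le> (1 - c) / 2 * r"
      by (rule nonexpansive)
    then show "\<bar>?G x n - ?G y n\<bar> \<le> r"
      unfolding comp_def cube_unmap_diff[OF e c] using c by (simp add: field_simps)
  qed
  \<comment> \<open>\<open>F\<close> moves coordinates towards 0, which is downwards in the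
    coordinates of the cube.\<close>
  have le: "?G x n \<le> x n" if "x \<in> conv_ball" for x n
  proof -
    have "cube_map e c x \<in> cube e c" using cube_map_in[OF e c] that by blast
    moreover from this have "F (cube_map e c x) \<in> cube e c" using bij_cube bij_betwE by blast
    ultimately have *: "cube_map e c x \<in> conv_ball" "c \<le> e n * cube_map e c x n"
      "c \<le> e n * F (cube_map e c x) n" by (auto simp: cube_def)
    have "e n * F (cube_map e c x) n \<le> e n * cube_map e c x n"
      using F_between[OF *(1), of n] *(2,3) c signs_cases[OF e, of n] by auto
    then have "?G x n \<le> cube_unmap e c (cube_map e c x) n"
      unfolding comp_def using c by (simp add: cube_unmap_def divide_right_mono)
    then show ?thesis by (simp add: cube_unmap_map[OF e c])
  qed
  show ?thesis
  proof
    fix f assume f: "f \<in> signs"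
    have "f n \<le> G.A f n" if "f \<in> signs" for f n
      using le[OF G.A_in[OF signs_conv_ball[OF that]], of n] G.F_A[OF signs_conv_ball[OF that]] by simp
    from this[OF f] this[OF signs_uminus[OF f]] have "G.A f n = f n" for n
      unfolding G.A_uminus[OF f] by (simp add: order_antisym)
    then have "G.A f = f" by blast
    then show "?G f = f" using G.F_A[OF signs_conv_ball[OF f]] by simp
  qed
qed

end

end

section \<open>Maps fixing the extreme points are the identity\<close>

lemma approx_cube:
  assumes z: "z \<in> conv_ball" and \<epsilon>: "0 < \<epsilon>" "\<epsilon> < 1"
  obtains e x where "e \<in> signs" "x \<in> cube e \<epsilon>" "\<And>n. \<bar>z n - x n\<bar> \<le> 2 * \<epsilon>"
proof -
  obtain e where e: "e \<in> signs" "\<And>n. e n * z n \<ge> - \<epsilon>"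
    using approx_sign[OF conv_ball_convergent[OF z] \<epsilon>(1)] by blast
  \<comment> \<open>Signed coordinates below \<open>\<epsilon>\<close> are raised to
    \<open>\<epsilon>\<close>; being at least \<open>- \<epsilon>\<close>, they move by at most
    \<open>2 * \<epsilon>\<close>.\<close>
  define x where "x = (\<lambda>n. e n * max (e n * z n) \<epsilon>)"
  obtain L M where "e \<longlonglongrightarrow> L" "z \<longlonglongrightarrow> M"
    using e(1) z by (auto simp: signs_def conv_ball_def convergent_def)
  then have "x \<longlonglongrightarrow> L * max (L * M) \<epsilon>"
    unfolding x_def by (intro tendsto_intros)
  then have "convergent x" by (auto simp: convergent_def)
  moreover have "\<bar>x n\<bar> \<le> 1" "\<epsilon> \<le> e n * x n" "\<bar>z n - x n\<bar> \<le> 2 * \<epsilon>" for n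
    using e(2)[of n] signs_cases[OF e(1), of n] conv_ball_le[OF z, of n] \<epsilon> by (auto simp: x_def)
  ultimately show ?thesis using that[OF e(1), of x] by (auto simp: cube_def conv_ball_def)
qed

text \<open>The start is the diameter 2 of the ball. \<open>F\<close> varies in the induction: the
  hypothesis is applied to the rescaled restriction to a cube, and scaling back costs a factor below
  1/2.\<close>

lemma sign_fixing_bijection_near_id:
  assumes "sign_fixing_bijection F" "z \<in> conv_ball"
  shows "\<bar>F z n - z n\<bar> \<le> 2 / 2 ^ k"
  using assms
proof (induction k arbitrary: F z n)
  case 0
  interpret sign_fixing_bijection F by fact
  show ?case using conv_ball_le[OF F_in[OF 0(2)], of n] conv_ball_le[OF 0(2), of n] by simp
next
  case (Suc k)
  interpret sign_fixing_bijection F by fact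
  have "\<bar>F z n - z n\<bar> \<le> 2 / 2 ^ Suc k + \<delta>" if "\<delta> > 0" for \<delta>
  proof -
    \<comment> \<open>Replacing \<open>z\<close> by \<open>x\<close> and \<open>F z\<close> by
      \<open>F x\<close> costs \<open>2 * \<epsilon>\<close> each, hence the quarter of
      \<open>\<delta>\<close>.\<close>
    define \<epsilon> where "\<epsilon> = min (\<delta> / 4) (1 / 2)"
    have \<epsilon>: "0 < \<epsilon>" "\<epsilon> < 1" "4 * \<epsilon> \<le> \<delta>" using that by (auto simp: \<epsilon>_def)
    obtain e x where ex: "e \<in> signs" "x \<in> cube e \<epsilon>" "\<And>n. \<bar>z n - x n\<bar> \<le> 2 * \<epsilon>"
      using approx_cube[OF Suc.prems(2) \<epsilon>(1,2)] by blast
    have x: "x \<in> conv_ball" using ex(2) by (simp add: cube_def)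
    note um = cube_map_unmap[OF ex(1) \<epsilon>(1,2)]
    have "\<bar>(cube_unmap e \<epsilon> \<circ> F \<circ> cube_map e \<epsilon>) (cube_unmap e \<epsilon> x) n - cube_unmap e \<epsilon> x n\<bar> \<le> 2 / 2 ^ k"
      by (rule Suc.IH[OF cube_rescale[OF ex(1) \<epsilon>(1,2)] cube_unmap_in[OF ex(1) \<epsilon>(1,2) ex(2)]])
    then have "\<bar>cube_unmap e \<epsilon> (F x) n - cube_unmap e \<epsilon> x n\<bar> \<le> 2 / 2 ^ k" by (simp add: um)
    then have "\<bar>F x n - x n\<bar> \<le> (1 - \<epsilon>) / 2 * (2 / 2 ^ k)"
      unfolding cube_unmap_diff[OF ex(1) \<epsilon>(1,2)] using \<epsilon> by (simp add: field_simps)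
    also have "\<dots> \<le> 1 / 2 * (2 / 2 ^ k)"
      by (rule mult_right_mono) (use \<epsilon> in auto)
    finally have "\<bar>F x n - x n\<bar> \<le> 2 / 2 ^ Suc k" by simp
    moreover have "\<bar>F z n - F x n\<bar> \<le> 2 * \<epsilon>"
      by (rule nonexpansive[OF Suc.prems(2) x ex(3)])
    ultimately show ?thesis using ex(3)[of n] \<epsilon>(3) by linarith
  qed
  then show ?case by (rule field_le_epsilon)
qed

lemma sign_fixing_bijection_id:
  assumes "sign_fixing_bijection F" "z \<in> conv_ball"
  shows "F z = z"
proof
  fix n
  have "(\<lambda>k. 2 * (1 / 2) ^ k) \<longlonglongrightarrow> 2 * (0::real)"
    by (intro tendsto_intros LIMSEQ_power_zero) simp
  then have "\<bar>F z n - z n\<bar> \<le> 2 * 0"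
  proof (rule LIMSEQ_le_const, intro exI allI impI)
    show "\<bar>F z n - z n\<bar> \<le> 2 * (1 / 2) ^ k" for k
      using sign_fixing_bijection_near_id[OF assms, of n k] by (simp add: power_one_over)
  qed
  then show "F z n = z n" by simp
qed

section \<open>Reduction to maps fixing the extreme points\<close>

text \<open>An injection of the naturals tends to infinity, since preimages of finite sets are
  finite.\<close>

lemma convergent_inj_comp:
  fixes x :: "nat \<Rightarrow> 'a::topological_space"
  assumes "convergent x" "inj p"
  shows "convergent (\<lambda>n. x (p n))"
proof -
  have "filterlim p sequentially sequentially"
    unfolding filterlim_iff using assms(2)
    by (auto simp: cofinite_eq_sequentially[symmetric] eventually_cofinite
        dest: finite_vimageI simp: vimage_def)
  then show ?thesis using assms(1) unfolding convergent_def by (metis filterlim_compose)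
qed

context nonexpansive_bijection
begin

text \<open>The extension to all sequences of the formula in \<open>A_signs_pi\<close> for
  \<open>A\<close> on signs.\<close>

definition sign_perm :: "(nat \<Rightarrow> real) \<Rightarrow> nat \<Rightarrow> real" where
  "sign_perm y = (\<lambda>m. \<sigma> m * y (inv \<pi> m))"

lemma bij_sign_perm: "bij_betw sign_perm conv_ball conv_ball"
proof (rule bij_betw_byWitness[where f' = "\<lambda>x n. \<sigma> (\<pi> n) * x (\<pi> n)"])
  have p: "inj \<pi>" "inj (inv \<pi>)" "\<pi> (inv \<pi> m) = m" "inv \<pi> (\<pi> m) = m" for m
    using bij_pi by (auto simp: bij_is_inj bij_imp_bij_inv bij_is_surj surj_f_inv_f inv_f_f)
  note s = signs_mult_self[OF sigma_signs]
  have conv: "convergent \<sigma>" using sigma_signs by (simp add: signs_def)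
  show "\<forall>y\<in>conv_ball. (\<lambda>n. \<sigma> (\<pi> n) * sign_perm y (\<pi> n)) = y"
    by (simp add: sign_perm_def mult.assoc[symmetric] s p)
  show "\<forall>x\<in>conv_ball. sign_perm (\<lambda>n. \<sigma> (\<pi> n) * x (\<pi> n)) = x"
    by (simp add: sign_perm_def mult.assoc[symmetric] s p)
  have a: "\<bar>\<sigma> m\<bar> = 1" for m using sigma_signs by (simp add: signs_def)
  show "sign_perm ` conv_ball \<subseteq> conv_ball"
  proof safe
    fix y assume y: "y \<in> conv_ball"
    show "sign_perm y \<in> conv_ball" unfolding sign_perm_def
      by (intro conv_ballI convergent_mult conv
          convergent_inj_comp[OF conv_ball_convergent[OF y] p(2)])
        (simp add: abs_mult a conv_ball_le[OF y])
  qed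
  show "(\<lambda>x n. \<sigma> (\<pi> n) * x (\<pi> n)) ` conv_ball \<subseteq> conv_ball"
  proof safe
    fix y assume y: "y \<in> conv_ball"
    show "(\<lambda>n. \<sigma> (\<pi> n) * y (\<pi> n)) \<in> conv_ball"
      by (intro conv_ballI convergent_mult convergent_inj_comp[OF conv p(1)]
          convergent_inj_comp[OF conv_ball_convergent[OF y] p(1)])
        (simp add: abs_mult a conv_ball_le[OF y])
  qed
qed

text \<open>\<open>F \<circ> sign_perm\<close> fixes the extreme points, hence is the identity; so
  \<open>sign_perm\<close> inverts \<open>F\<close> on the whole ball.\<close>

lemma F_sign_perm:
  assumes "y \<in> conv_ball"
  shows "F (sign_perm y) = y"
proof -
  have s: "\<bar>\<sigma> m\<bar> = 1" for m using sigma_signs by (simp add: signs_def)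
  have "sign_fixing_bijection (F \<circ> sign_perm)"
  proof
    show "bij_betw (F \<circ> sign_perm) conv_ball conv_ball" by (rule bij_betw_trans[OF bij_sign_perm bij])
  next
    fix x y r n
    assume xy: "x \<in> conv_ball" "y \<in> conv_ball" "\<And>k. \<bar>x k - y k\<bar> \<le> r"
    have "\<bar>sign_perm x k - sign_perm y k\<bar> \<le> r" for k
      using xy(3) s by (simp add: sign_perm_def right_diff_distrib[symmetric] abs_mult)
    then show "\<bar>(F \<circ> sign_perm) x n - (F \<circ> sign_perm) y n\<bar> \<le> r"
      using nonexpansive xy bij_betwE[OF bij_sign_perm] by simp
  next
    fix e assume e: "e \<in> signs"
    have "sign_perm e m = A e m" for m
      using A_signs_pi[OF e, of "inv \<pi> m"] bij_pi by (simp add: sign_perm_def bij_is_surj surj_f_inv_f)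
    then have "sign_perm e = A e" by blast
    then show "(F \<circ> sign_perm) e = e" using F_A[OF signs_conv_ball[OF e]] by simp
  qed
  from sign_fixing_bijection_id[OF this assms] show ?thesis by simp
qed

lemma ex_coordinate_isometry:
  assumes "x \<in> conv_ball" "y \<in> conv_ball"
  shows "\<exists>n. \<bar>x m - y m\<bar> = \<bar>F x n - F y n\<bar>"
proof -
  obtain u v where uv: "u \<in> conv_ball" "v \<in> conv_ball" "x = sign_perm u" "y = sign_perm v"
    using assms bij_sign_perm by (metis bij_betw_imp_surj_on imageE)
  have "\<bar>\<sigma> m\<bar> = 1" using sigma_signs by (simp add: signs_def)
  then have "\<bar>x m - y m\<bar> = \<bar>F x (inv \<pi> m) - F y (inv \<pi> m)\<bar>"
    using uv F_sign_perm by (simp add: sign_perm_def right_diff_distrib[symmetric] abs_mult)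
  then show ?thesis by blast
qed

end

section \<open>Transfer to the unit ball of the Banach space\<close>

lemma dist_bcontfun_le_iff:
  fixes x y :: "nat \<Rightarrow>\<^sub>C real"
  shows "dist x y \<le> r \<longleftrightarrow> (\<forall>n. \<bar>apply_bcontfun x n - apply_bcontfun y n\<bar> \<le> r)"
  unfolding dist_real_def[symmetric]
  using dist_bounded[of x _ y] dist_bound[of x y r] order_trans by blast

lemma bij_conv_ball: "bij_betw apply_bcontfun c_unit_ball conv_ball"
proof -
  have "norm x \<le> 1 \<longleftrightarrow> (\<forall>n. \<bar>apply_bcontfun x n\<bar> \<le> 1)" for x :: "nat \<Rightarrow>\<^sub>C real"
    using dist_bcontfun_le_iff[of x 0 1] by (simp add: dist_norm)
  then have ball: "x \<in> c_unit_ball \<longleftrightarrow> x \<in> c_space \<and> apply_bcontfun x \<in> conv_ball" for x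
    by (auto simp: c_unit_ball_def conv_ball_def c_space_def)
  show ?thesis
  proof (rule bij_betw_subset[OF bij_betw_c_space])
    show "c_unit_ball \<subseteq> c_space" using ball by blast
    show "apply_bcontfun ` c_unit_ball = conv_ball"
    proof (intro equalityI subsetI)
      fix f assume f: "f \<in> conv_ball"
      then obtain x where "x \<in> c_space" "f = apply_bcontfun x"
        using bij_betw_imp_surj_on[OF bij_betw_c_space] conv_ball_convergent by blast
      then show "f \<in> apply_bcontfun ` c_unit_ball" using f ball by blast
    qed (use ball in blast)
  qed
qed

theorem theorem4p1:
  fixes F :: "(nat \<Rightarrow>\<^sub>C real) \<Rightarrow> (nat \<Rightarrow>\<^sub>C real)"
  assumes "bij_betw F c_unit_ball c_unit_ball"
    and "non_expansive_on c_unit_ball F"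
  shows "\<forall>x\<in>c_unit_ball. \<forall>y\<in>c_unit_ball. norm (F x - F y) = norm (x - y)"
proof (intro ballI antisym)
  define H where "H = inv_into c_unit_ball apply_bcontfun"
  define G where "G = apply_bcontfun \<circ> F \<circ> H"
  have H: "bij_betw H conv_ball c_unit_ball"
    unfolding H_def by (rule bij_betw_inv_into[OF bij_conv_ball])
  have apply_H: "apply_bcontfun (H f) = f" if "f \<in> conv_ball" for f
    unfolding H_def by (rule bij_betw_inv_into_right[OF bij_conv_ball that])
  have H_apply: "H (apply_bcontfun x) = x" if "x \<in> c_unit_ball" for x
    unfolding H_def by (rule bij_betw_inv_into_left[OF bij_conv_ball that])
  interpret nonexpansive_bijection G
  proof
    show "bij_betw G conv_ball conv_ball"
      unfolding G_def comp_assoc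
      by (rule bij_betw_trans[OF bij_betw_trans[OF H assms(1)] bij_conv_ball, unfolded comp_assoc])
  next
    fix x y r n
    assume xy: "x \<in> conv_ball" "y \<in> conv_ball" "\<And>k. \<bar>x k - y k\<bar> \<le> r"
    have "H x \<in> c_unit_ball" "H y \<in> c_unit_ball" using xy H bij_betwE by blast+
    then have "dist (F (H x)) (F (H y)) \<le> dist (H x) (H y)"
      using assms(2) by (simp add: non_expansive_on_def)
    also have "\<dots> \<le> r" using xy apply_H by (simp add: dist_bcontfun_le_iff)
    finally show "\<bar>G x n - G y n\<bar> \<le> r" by (simp add: G_def dist_bcontfun_le_iff)
  qed
  fix x y assume xy: "x \<in> c_unit_ball" "y \<in> c_unit_ball"
  show "norm (F x - F y) \<le> norm (x - y)"
    using assms(2) xy by (simp add: non_expansive_on_def dist_norm)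
  \<comment> \<open>Each coordinate difference of \<open>x\<close> and \<open>y\<close> reappears,
    up to sign, between \<open>F x\<close> and \<open>F y\<close>, which yields the reverse
    inequality.\<close>
  have "\<bar>apply_bcontfun x m - apply_bcontfun y m\<bar> \<le> dist (F x) (F y)" for m
  proof -
    have "apply_bcontfun x \<in> conv_ball" "apply_bcontfun y \<in> conv_ball"
      using xy bij_conv_ball bij_betwE by blast+
    from ex_coordinate_isometry[OF this, of m]
    obtain n where "\<bar>apply_bcontfun x m - apply_bcontfun y m\<bar>
        = \<bar>apply_bcontfun (F x) n - apply_bcontfun (F y) n\<bar>"
      by (auto simp: G_def H_apply xy)
    then show ?thesis using dist_bcontfun_le_iff[of "F x" "F y" "dist (F x) (F y)"] by simp
  qed
  then show "norm (x - y) \<le> norm (F x - F y)"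
    by (simp add: dist_bcontfun_le_iff flip: dist_norm)
qed

end
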